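(* Let $F$ be a topological space that is either compact Hausdorff, or locally connected, locally compact and Hausdorff. Let $G$ be the group $\mathrm{Homeo}(F)$ of self-homeomorphisms of $F$ endowed with the compact-open topology. Let $B$ be a topological space and let $\kappa$ be a cardinal. Then any $F$-fiber bundle $p:E\to B$ that is covered by $\kappa$-many local trivializations $\{U_i\times F\}_{i\in I}$ is isomorphic to the pullback $f^*(E^\kappa G\times_G F)$ for some continuous map $f:B\to B^\kappa G$.
   Context: An $F$-fiber bundle $p:E\to B$ is a locally trivial bundle with fiber $F$ and no given structure group; "covered by $\kappa$-many local trivializations" means there is an open cover $\{U_i\}_{i\in I}$ of $B$, $\mathrm{card}(I)=\kappa$, with $p^{-1}(U_i)\approx U_i\times F$ over $U_i$. Isomorphism means homeomorphism over $B$. For a topological space $(A,\mathcal{T})$, the indiscrete cone $c(A,\mathcal{T})$ is the set $A\sqcup\{0\}$ with topology $\mathcal{T}\cup\{A\sqcup\{0\}\}$. For a topological group $G$, a cardinal $\kappa$ and a set $I$ with $\mathrm{card}(I)=\kappa$, $E^\kappa G:=(c(G))^I-\{0\}^I$ with the subspace topology of the product topology, with right $G$-action that is diagonal and given by right multiplication on $G$ and fixing $0$; $B^\kappa G:=E^\kappa G/G$ with the quotient topology. $G=\mathrm{Homeo}(F)$ acts on $F$ on the left by evaluation; $E^\kappa G\times_G F:=(E^\kappa G\times F)/((eg,y)\sim(e,gy))$, which projects to $B^\kappa G$, and the pullback is taken along this projection. *)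

theory Defs
  imports "HOL-Analysis.Analysis" "HOL-Algebra.Bij"
begin

unbundle cardinal_syntax

section \<open>Fiber bundles, isomorphism over the base, pullbacks\<close>

definition local_trivialization ::
    "'f topology \<Rightarrow> 'e topology \<Rightarrow> 'b topology \<Rightarrow> ('e \<Rightarrow> 'b) \<Rightarrow> 'b set \<Rightarrow> ('e \<Rightarrow> 'b \<times> 'f) \<Rightarrow> bool" where
  "local_trivialization F E B p U \<phi> \<longleftrightarrow>
     homeomorphic_map (subtopology E {x \<in> topspace E. p x \<in> U})
                      (prod_topology (subtopology B U) F) \<phi> \<and>
     (\<forall>x \<in> topspace E. p x \<in> U \<longrightarrow> fst (\<phi> x) = p x)"

definition fiber_bundle ::
    "'f topology \<Rightarrow> 'e topology \<Rightarrow> 'b topology \<Rightarrow> ('e \<Rightarrow> 'b) \<Rightarrow> bool" where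
  "fiber_bundle F E B p \<longleftrightarrow>
     continuous_map E B p \<and>
     (\<forall>b \<in> topspace B. \<exists>U \<phi>. openin B U \<and> b \<in> U \<and> local_trivialization F E B p U \<phi>)"

definition trivializing_cover ::
    "'f topology \<Rightarrow> 'e topology \<Rightarrow> 'b topology \<Rightarrow> ('e \<Rightarrow> 'b) \<Rightarrow> 'i set \<Rightarrow> ('i \<Rightarrow> 'b set) \<Rightarrow> bool" where
  "trivializing_cover F E B p J U \<longleftrightarrow>
     (\<forall>i \<in> J. openin B (U i)) \<and> (\<Union>i \<in> J. U i) = topspace B \<and>
     (\<forall>i \<in> J. \<exists>\<phi>. local_trivialization F E B p (U i) \<phi>)"

definition isomorphic_over ::
    "'b topology \<Rightarrow> 'e topology \<Rightarrow> ('e \<Rightarrow> 'b) \<Rightarrow> 'd topology \<Rightarrow> ('d \<Rightarrow> 'b) \<Rightarrow> bool" where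
  "isomorphic_over B E p D q \<longleftrightarrow>
     continuous_map E B p \<and> continuous_map D B q \<and>
     (\<exists>h. homeomorphic_map E D h \<and> (\<forall>x \<in> topspace E. q (h x) = p x))"

definition pullback_space ::
    "'b topology \<Rightarrow> ('b \<Rightarrow> 'c) \<Rightarrow> 'd topology \<Rightarrow> ('d \<Rightarrow> 'c) \<Rightarrow> ('b \<times> 'd) topology" where
  "pullback_space B f D q =
     subtopology (prod_topology B D) {(b, x). b \<in> topspace B \<and> x \<in> topspace D \<and> f b = q x}"

section \<open>Quotient spaces\<close>

text \<open>The relation \<open>r\<close> is meant to be an equivalence relation on \<open>topspace X\<close>; this is proved
  below for every relation to which the construction is applied.\<close>

definition quotient_space :: "'a topology \<Rightarrow> ('a \<times> 'a) set \<Rightarrow> 'a set topology" where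
  "quotient_space X r =
     topology (\<lambda>W. W \<subseteq> topspace X // r \<and> openin X {x \<in> topspace X. r `` {x} \<in> W})"

lemma openin_quotient_space:
  "openin (quotient_space X r) W \<longleftrightarrow>
     W \<subseteq> topspace X // r \<and> openin X {x \<in> topspace X. r `` {x} \<in> W}"
proof -
  let ?P = "\<lambda>W. W \<subseteq> topspace X // r \<and> openin X {x \<in> topspace X. r `` {x} \<in> W}"
  have "?P (S \<inter> T)" if "?P S" "?P T" for S T
  proof -
    have "{x \<in> topspace X. r `` {x} \<in> S \<inter> T} =
        {x \<in> topspace X. r `` {x} \<in> S} \<inter> {x \<in> topspace X. r `` {x} \<in> T}" by auto
    then show ?thesis using that by (auto simp: openin_Int)
  qed
  moreover have "?P (\<Union>K)" if "\<forall>S\<in>K. ?P S" for K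
  proof -
    have "{x \<in> topspace X. r `` {x} \<in> \<Union>K} = (\<Union>S\<in>K. {x \<in> topspace X. r `` {x} \<in> S})" by auto
    then show ?thesis using that by auto
  qed
  ultimately have "istopology ?P"
    unfolding istopology_def by blast
  then show ?thesis
    by (simp add: quotient_space_def topology_inverse')
qed

lemma topspace_quotient_space: "topspace (quotient_space X r) = topspace X // r"
proof -
  have "{x \<in> topspace X. r `` {x} \<in> topspace X // r} = topspace X"
    by (auto simp: quotient_def)
  then have "openin (quotient_space X r) (topspace X // r)"
    by (simp add: openin_quotient_space)
  then show ?thesis
    by (metis openin_quotient_space openin_subset openin_topspace subset_antisym)
qed

lemma quotient_map_quotient_space:
  "quotient_map X (quotient_space X r) (\<lambda>x. r `` {x})"
  unfolding quotient_map_def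
  by (auto simp: topspace_quotient_space openin_quotient_space quotient_def)

section \<open>The indiscrete cone\<close>

text \<open>\<open>None\<close> is the cone point \<open>0\<close>.\<close>

definition indiscrete_cone :: "'a topology \<Rightarrow> 'a option topology" where
  "indiscrete_cone X =
     topology (\<lambda>W. (\<exists>U. openin X U \<and> W = Some ` U) \<or> W = insert None (Some ` topspace X))"

lemma openin_indiscrete_cone:
  "openin (indiscrete_cone X) W \<longleftrightarrow>
     (\<exists>U. openin X U \<and> W = Some ` U) \<or> W = insert None (Some ` topspace X)"
proof -
  let ?P = "\<lambda>W. (\<exists>U. openin X U \<and> W = Some ` U) \<or> W = insert None (Some ` topspace X)"
  have sub: "W \<subseteq> insert None (Some ` topspace X)" if "?P W" for W
    using that openin_subset by fastforce
  have P_Int: "?P (S \<inter> T)" if PS: "?P S" and PT: "?P T" for S T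
  proof (cases "S = insert None (Some ` topspace X) \<or> T = insert None (Some ` topspace X)")
    case True
    then have "S \<inter> T = S \<or> S \<inter> T = T"
      using sub[OF PS] sub[OF PT] by blast
    then show ?thesis
    proof
      assume eq: "S \<inter> T = S"
      show ?thesis unfolding eq by (rule PS)
    next
      assume eq: "S \<inter> T = T"
      show ?thesis unfolding eq by (rule PT)
    qed
  next
    case False
    then have ne: "S \<noteq> insert None (Some ` topspace X)" "T \<noteq> insert None (Some ` topspace X)"
      by simp_all
    obtain U where "openin X U" "S = Some ` U"
      using PS ne(1) by (elim disjE exE conjE) simp_all
    moreover obtain V where "openin X V" "T = Some ` V"
      using PT ne(2) by (elim disjE exE conjE) simp_all
    ultimately have "openin X (U \<inter> V) \<and> S \<inter> T = Some ` (U \<inter> V)"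
      by (simp add: openin_Int image_Int)
    then show ?thesis by blast
  qed
  have P_Union: "?P (\<Union>K)" if K: "\<forall>S\<in>K. ?P S" for K
  proof (cases "insert None (Some ` topspace X) \<in> K")
    case True
    then have "\<Union>K = insert None (Some ` topspace X)"
      using K sub by blast
    then show ?thesis by blast
  next
    case False
    then have "\<forall>S\<in>K. \<exists>U. openin X U \<and> S = Some ` U" using K by metis
    then obtain u where u: "\<And>S. S \<in> K \<Longrightarrow> openin X (u S)"
      and Some_u: "\<And>S. S \<in> K \<Longrightarrow> Some ` u S = S"
      by metis
    have "openin X (\<Union>S\<in>K. u S)" using u by blast
    moreover have "\<Union>K = Some ` (\<Union>S\<in>K. u S)" by (simp add: image_UN Some_u)
    ultimately show ?thesis by (intro disjI1 exI conjI)
  qed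
  have "istopology ?P"
    unfolding istopology_def
  proof (intro conjI allI impI)
    fix S T assume "?P S" "?P T"
    then show "?P (S \<inter> T)" by (rule P_Int)
  next
    fix K assume "\<forall>S\<in>K. ?P S"
    then show "?P (\<Union>K)" by (rule P_Union)
  qed
  then show ?thesis
    by (simp add: indiscrete_cone_def topology_inverse')
qed

lemma topspace_indiscrete_cone:
  "topspace (indiscrete_cone X) = insert None (Some ` topspace X)"
proof (rule subset_antisym)
  show "topspace (indiscrete_cone X) \<subseteq> insert None (Some ` topspace X)"
    using openin_topspace[of "indiscrete_cone X"] openin_subset[of X]
    unfolding openin_indiscrete_cone by blast
  show "insert None (Some ` topspace X) \<subseteq> topspace (indiscrete_cone X)"
    by (rule openin_subset) (simp add: openin_indiscrete_cone)
qed

section \<open>The bundles over \<open>B\<^sup>\<kappa> G\<close>\<close>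

text \<open>A topological group is given by a group \<open>G\<close> and a topology \<open>T\<close> with
  \<open>topspace T = carrier G\<close>; the cardinal enters through the index set \<open>I\<close>.\<close>

definition E_space :: "'g topology \<Rightarrow> 'i set \<Rightarrow> ('i \<Rightarrow> 'g option) topology" where
  "E_space T I =
     (let P = product_topology (\<lambda>_. indiscrete_cone T) I
      in subtopology P (topspace P - {\<lambda>i\<in>I. None}))"

definition E_act ::
    "('g, 'm) monoid_scheme \<Rightarrow> 'i set \<Rightarrow> ('i \<Rightarrow> 'g option) \<Rightarrow> 'g \<Rightarrow> ('i \<Rightarrow> 'g option)" where
  "E_act G I e g = (\<lambda>i\<in>I. map_option (\<lambda>a. a \<otimes>\<^bsub>G\<^esub> g) (e i))"

definition E_orbit_rel ::
    "('g, 'm) monoid_scheme \<Rightarrow> 'g topology \<Rightarrow> 'i set \<Rightarrow> (('i \<Rightarrow> 'g option) \<times> ('i \<Rightarrow> 'g option)) set" where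
  "E_orbit_rel G T I = {(e, E_act G I e g) | e g. e \<in> topspace (E_space T I) \<and> g \<in> carrier G}"

definition B_space ::
    "('g, 'm) monoid_scheme \<Rightarrow> 'g topology \<Rightarrow> 'i set \<Rightarrow> ('i \<Rightarrow> 'g option) set topology" where
  "B_space G T I = quotient_space (E_space T I) (E_orbit_rel G T I)"

text \<open>\<open>act\<close> is a left action of \<open>G\<close> on \<open>F\<close>. Because \<open>G\<close> acts by a group action, the identifications
  \<open>(e g, y) \<sim> (e, g y)\<close> already form an equivalence relation.\<close>

definition assoc_rel ::
    "('g, 'm) monoid_scheme \<Rightarrow> 'g topology \<Rightarrow> 'i set \<Rightarrow> 'f topology \<Rightarrow> ('g \<Rightarrow> 'f \<Rightarrow> 'f)
      \<Rightarrow> ((('i \<Rightarrow> 'g option) \<times> 'f) \<times> (('i \<Rightarrow> 'g option) \<times> 'f)) set" where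
  "assoc_rel G T I F act =
     {((E_act G I e g, y), (e, act g y)) | e g y.
        e \<in> topspace (E_space T I) \<and> g \<in> carrier G \<and> y \<in> topspace F}"

definition assoc_space ::
    "('g, 'm) monoid_scheme \<Rightarrow> 'g topology \<Rightarrow> 'i set \<Rightarrow> 'f topology \<Rightarrow> ('g \<Rightarrow> 'f \<Rightarrow> 'f)
      \<Rightarrow> (('i \<Rightarrow> 'g option) \<times> 'f) set topology" where
  "assoc_space G T I F act =
     quotient_space (prod_topology (E_space T I) F) (assoc_rel G T I F act)"

text \<open>The projection sends the class of \<open>(e, y)\<close> to the orbit of \<open>e\<close>, see \<open>assoc_proj_class\<close>.\<close>

definition assoc_proj ::
    "('g, 'm) monoid_scheme \<Rightarrow> 'g topology \<Rightarrow> 'i set \<Rightarrow> (('i \<Rightarrow> 'g option) \<times> 'f) set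
      \<Rightarrow> ('i \<Rightarrow> 'g option) set" where
  "assoc_proj G T I C = the_elem ((\<lambda>(e, y). E_orbit_rel G T I `` {e}) ` C)"

lemma topspace_E_space:
  "topspace (E_space T I) = (I \<rightarrow>\<^sub>E insert None (Some ` topspace T)) - {\<lambda>i\<in>I. None}"
  by (auto simp: E_space_def Let_def topspace_indiscrete_cone)

context
  fixes G :: "('g, 'm) monoid_scheme" and T :: "'g topology"
  assumes G: "group G" and T: "topspace T = carrier G"
begin

interpretation group G by (rule G)

lemma E_act_closed:
  assumes "e \<in> topspace (E_space T I)" "g \<in> carrier G"
  shows "E_act G I e g \<in> topspace (E_space T I)"
proof -
  have e: "e \<in> I \<rightarrow>\<^sub>E insert None (Some ` carrier G)" "e \<noteq> (\<lambda>i\<in>I. None)"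
    using assms by (auto simp: topspace_E_space T)
  then obtain i where i: "i \<in> I" "e i \<noteq> None"
    by (metis PiE_restrict restrict_ext)
  then have "E_act G I e g i \<noteq> None" by (simp add: E_act_def)
  then have "E_act G I e g \<noteq> (\<lambda>i\<in>I. None)" using i by (metis restrict_apply')
  moreover have "E_act G I e g \<in> I \<rightarrow>\<^sub>E insert None (Some ` carrier G)"
  proof (rule PiE_I)
    fix j assume "j \<in> I"
    then have "e j \<in> insert None (Some ` carrier G)" using e(1) by blast
    then show "E_act G I e g j \<in> insert None (Some ` carrier G)"
      using \<open>j \<in> I\<close> assms(2) by (auto simp: E_act_def)
  qed (simp add: E_act_def)
  ultimately show ?thesis by (simp add: topspace_E_space T)
qed

lemma E_act_one:
  assumes "e \<in> topspace (E_space T I)"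
  shows "E_act G I e \<one>\<^bsub>G\<^esub> = e"
proof
  fix i
  have e: "e \<in> I \<rightarrow>\<^sub>E insert None (Some ` carrier G)"
    using assms by (auto simp: topspace_E_space T)
  show "E_act G I e \<one>\<^bsub>G\<^esub> i = e i"
  proof (cases "i \<in> I")
    case True
    then have "e i \<in> insert None (Some ` carrier G)" using e by blast
    then show ?thesis using True by (auto simp: E_act_def)
  next
    case False
    then show ?thesis using PiE_arb[OF e] by (simp add: E_act_def)
  qed
qed

lemma E_act_mult:
  assumes "e \<in> topspace (E_space T I)" "g \<in> carrier G" "h \<in> carrier G"
  shows "E_act G I (E_act G I e g) h = E_act G I e (g \<otimes>\<^bsub>G\<^esub> h)"
proof
  fix i
  have e: "e \<in> I \<rightarrow>\<^sub>E insert None (Some ` carrier G)"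
    using assms by (auto simp: topspace_E_space T)
  show "E_act G I (E_act G I e g) h i = E_act G I e (g \<otimes>\<^bsub>G\<^esub> h) i"
  proof (cases "i \<in> I")
    case True
    then have "e i \<in> insert None (Some ` carrier G)" using e by blast
    then show ?thesis using True assms by (auto simp: E_act_def m_assoc)
  qed (simp add: E_act_def)
qed

lemma equiv_E_orbit_rel: "equiv (topspace (E_space T I)) (E_orbit_rel G T I)"
proof (rule equivI)
  show "E_orbit_rel G T I \<subseteq> topspace (E_space T I) \<times> topspace (E_space T I)"
    by (auto simp: E_orbit_rel_def E_act_closed)
  show "refl_on (topspace (E_space T I)) (E_orbit_rel G T I)"
    unfolding refl_on_def E_orbit_rel_def using E_act_one one_closed by force
  show "sym (E_orbit_rel G T I)"
  proof (rule symI)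
    fix a b assume "(a, b) \<in> E_orbit_rel G T I"
    then obtain g where g: "a \<in> topspace (E_space T I)" "g \<in> carrier G" "b = E_act G I a g"
      by (auto simp: E_orbit_rel_def)
    then have "E_act G I b (inv\<^bsub>G\<^esub> g) = a" by (simp add: E_act_mult E_act_one)
    moreover have "b \<in> topspace (E_space T I)" using g by (simp add: E_act_closed)
    ultimately show "(b, a) \<in> E_orbit_rel G T I"
      unfolding E_orbit_rel_def using inv_closed[OF g(2)] by force
  qed
  show "trans (E_orbit_rel G T I)"
  proof (rule transI)
    fix a b c assume "(a, b) \<in> E_orbit_rel G T I" "(b, c) \<in> E_orbit_rel G T I"
    then obtain g h where g: "a \<in> topspace (E_space T I)" "g \<in> carrier G" "b = E_act G I a g"
      and h: "h \<in> carrier G" "c = E_act G I b h"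
      by (auto simp: E_orbit_rel_def)
    then have "c = E_act G I a (g \<otimes>\<^bsub>G\<^esub> h)" by (simp add: E_act_mult)
    then show "(a, c) \<in> E_orbit_rel G T I"
      unfolding E_orbit_rel_def using g h by blast
  qed
qed

context
  fixes F :: "'f topology" and act :: "'g \<Rightarrow> 'f \<Rightarrow> 'f"
  assumes act_closed: "\<And>g y. g \<in> carrier G \<Longrightarrow> y \<in> topspace F \<Longrightarrow> act g y \<in> topspace F"
    and act_one: "\<And>y. y \<in> topspace F \<Longrightarrow> act \<one>\<^bsub>G\<^esub> y = y"
    and act_mult: "\<And>g h y. g \<in> carrier G \<Longrightarrow> h \<in> carrier G \<Longrightarrow> y \<in> topspace F \<Longrightarrow>
      act (g \<otimes>\<^bsub>G\<^esub> h) y = act g (act h y)"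
begin

lemma assoc_rel_iff:
  "((d, x), (e, y)) \<in> assoc_rel G T I F act \<longleftrightarrow>
     d \<in> topspace (E_space T I) \<and> e \<in> topspace (E_space T I) \<and> x \<in> topspace F \<and>
     (\<exists>g\<in>carrier G. d = E_act G I e g \<and> y = act g x)"
  by (auto simp: assoc_rel_def E_act_closed)

lemma equiv_assoc_rel:
  "equiv (topspace (prod_topology (E_space T I) F)) (assoc_rel G T I F act)"
proof (rule equivI)
  show "assoc_rel G T I F act \<subseteq>
      topspace (prod_topology (E_space T I) F) \<times> topspace (prod_topology (E_space T I) F)"
    by (auto simp: assoc_rel_def E_act_closed act_closed)
  show "refl_on (topspace (prod_topology (E_space T I) F)) (assoc_rel G T I F act)"
    unfolding refl_on_def
    by (auto simp: assoc_rel_iff E_act_one act_one intro!: bexI[of _ "\<one>\<^bsub>G\<^esub>"])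
  show "sym (assoc_rel G T I F act)"
  proof (rule symI, clarify)
    fix d x e y assume "((d, x), (e, y)) \<in> assoc_rel G T I F act"
    then obtain g where g: "d \<in> topspace (E_space T I)" "e \<in> topspace (E_space T I)"
        "x \<in> topspace F" "g \<in> carrier G" "d = E_act G I e g" "y = act g x"
      by (auto simp: assoc_rel_iff)
    then have "e = E_act G I d (inv\<^bsub>G\<^esub> g)" "x = act (inv\<^bsub>G\<^esub> g) y"
      by (simp_all add: E_act_mult E_act_one act_mult[symmetric] act_one)
    moreover have "y \<in> topspace F" "inv\<^bsub>G\<^esub> g \<in> carrier G" using g by (simp_all add: act_closed)
    ultimately show "((e, y), (d, x)) \<in> assoc_rel G T I F act"
      using g by (auto simp only: assoc_rel_iff)
  qed
  show "trans (assoc_rel G T I F act)"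
  proof (rule transI, clarify)
    fix d x e y c z
    assume "((d, x), (e, y)) \<in> assoc_rel G T I F act" "((e, y), (c, z)) \<in> assoc_rel G T I F act"
    then obtain g h where "d \<in> topspace (E_space T I)" "c \<in> topspace (E_space T I)"
        "x \<in> topspace F" "g \<in> carrier G" "d = E_act G I e g" "y = act g x"
        "h \<in> carrier G" "e = E_act G I c h" "z = act h y"
      by (auto simp: assoc_rel_iff)
    moreover from this have "d = E_act G I c (h \<otimes>\<^bsub>G\<^esub> g)" "z = act (h \<otimes>\<^bsub>G\<^esub> g) x"
      by (simp_all add: E_act_mult act_mult)
    ultimately show "((d, x), (c, z)) \<in> assoc_rel G T I F act"
      unfolding assoc_rel_iff using m_closed by blast
  qed
qed

lemma assoc_proj_class:
  assumes "e \<in> topspace (E_space T I)" "y \<in> topspace F"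
  shows "assoc_proj G T I (assoc_rel G T I F act `` {(e, y)}) = E_orbit_rel G T I `` {e}"
proof -
  have "E_orbit_rel G T I `` {d} = E_orbit_rel G T I `` {e}"
    if "((e, y), (d, x)) \<in> assoc_rel G T I F act" for d x
  proof -
    have "(d, e) \<in> E_orbit_rel G T I"
      using that by (auto simp: assoc_rel_iff E_orbit_rel_def)
    then show ?thesis by (rule equiv_class_eq[OF equiv_E_orbit_rel])
  qed
  moreover have "((e, y), (e, y)) \<in> assoc_rel G T I F act"
    using equiv_class_self[OF equiv_assoc_rel, of "(e, y)"] assms by auto
  ultimately have "(\<lambda>(d, x). E_orbit_rel G T I `` {d}) ` (assoc_rel G T I F act `` {(e, y)})
      = {E_orbit_rel G T I `` {e}}" (is "?L = _")
  proof (intro subset_antisym subsetI)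
    assume cls: "\<And>d x. ((e, y), (d, x)) \<in> assoc_rel G T I F act \<Longrightarrow>
        E_orbit_rel G T I `` {d} = E_orbit_rel G T I `` {e}"
      and self: "((e, y), (e, y)) \<in> assoc_rel G T I F act"
    show "C \<in> {E_orbit_rel G T I `` {e}}" if "C \<in> ?L" for C
      using that cls by (elim imageE) (simp only: Image_singleton_iff split_paired_all, simp)
    show "C \<in> ?L" if "C \<in> {E_orbit_rel G T I `` {e}}" for C
      using that self by (intro image_eqI[of _ _ "(e, y)"]) simp_all
  qed
  then show ?thesis by (simp add: assoc_proj_def)
qed

end

end

section \<open>The homeomorphism group\<close>

text \<open>Maps \<open>topspace X \<rightarrow> topspace Y\<close> are represented by extensional functions.\<close>

definition compact_open_topology :: "'a topology \<Rightarrow> 'b topology \<Rightarrow> ('a \<Rightarrow> 'b) topology" where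
  "compact_open_topology X Y =
     topology_generated_by
       {{f \<in> extensional (topspace X). continuous_map X Y f \<and> f ` K \<subseteq> V} | K V.
          compactin X K \<and> openin Y V}"

lemma topspace_compact_open_topology:
  "topspace (compact_open_topology X Y) = {f \<in> extensional (topspace X). continuous_map X Y f}"
proof -
  have "{f \<in> extensional (topspace X). continuous_map X Y f} \<in>
      {{f \<in> extensional (topspace X). continuous_map X Y f \<and> f ` K \<subseteq> V} | K V.
          compactin X K \<and> openin Y V}"
    by (intro CollectI exI[of _ "{}"]) auto
  then show ?thesis
    unfolding compact_open_topology_def topology_generated_by_topspace by blast
qed

definition Homeo :: "'a topology \<Rightarrow> ('a \<Rightarrow> 'a) monoid" where
  "Homeo F = (BijGroup (topspace F))
     \<lparr>carrier := {g \<in> Bij (topspace F). homeomorphic_map F F g}\<rparr>"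

definition Homeo_topology :: "'a topology \<Rightarrow> ('a \<Rightarrow> 'a) topology" where
  "Homeo_topology F = subtopology (compact_open_topology F F) (carrier (Homeo F))"

lemma topspace_Homeo_topology: "topspace (Homeo_topology F) = carrier (Homeo F)"
  by (auto simp: Homeo_topology_def topspace_compact_open_topology Homeo_def Bij_def
      homeomorphic_imp_continuous_map)

lemma carrier_Homeo:
  "carrier (Homeo F) = {g \<in> extensional (topspace F). homeomorphic_map F F g}"
proof -
  have "bij_betw g (topspace F) (topspace F)" if "homeomorphic_map F F g" for g
    using that homeomorphic_imp_injective_map homeomorphic_imp_surjective_map
    unfolding bij_betw_def by blast
  then show ?thesis by (auto simp: Homeo_def Bij_def)
qed

lemma group_Homeo: "group (Homeo F)"
proof -
  have "subgroup {g \<in> Bij (topspace F). homeomorphic_map F F g} (BijGroup (topspace F))"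
  proof (rule group.subgroupI[OF group_BijGroup])
    show "{g \<in> Bij (topspace F). homeomorphic_map F F g} \<subseteq> carrier (BijGroup (topspace F))"
      by (auto simp: BijGroup_def)
    have "(\<lambda>x\<in>topspace F. x) \<in> {g \<in> Bij (topspace F). homeomorphic_map F F g}"
      using homeomorphic_map_eq[OF homeomorphic_map_id[THEN iffD2, OF refl], of F "\<lambda>x\<in>topspace F. x"]
      by (simp add: id_Bij)
    then show "{g \<in> Bij (topspace F). homeomorphic_map F F g} \<noteq> {}" by blast
  next
    fix g assume g: "g \<in> {g \<in> Bij (topspace F). homeomorphic_map F F g}"
    then obtain h where h: "homeomorphic_maps F F g h" "homeomorphic_map F F h"
      by (metis (no_types, lifting) homeomorphic_map_maps homeomorphic_maps_sym mem_Collect_eq)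
    have "inv_into (topspace F) g x = h x" if "x \<in> topspace F" for x
    proof (rule inv_into_f_eq)
      show "inj_on g (topspace F)" using g by (simp add: Bij_def bij_betw_def)
      show "h x \<in> topspace F" "g (h x) = x"
        using h that by (auto simp: homeomorphic_maps_def continuous_map_def)
    qed
    then have "homeomorphic_map F F (\<lambda>x\<in>topspace F. inv_into (topspace F) g x)"
      using h by (auto intro: homeomorphic_map_eq)
    then show "inv\<^bsub>BijGroup (topspace F)\<^esub> g \<in> {g \<in> Bij (topspace F). homeomorphic_map F F g}"
      using g by (auto simp: inv_BijGroup restrict_inv_into_Bij)
  next
    fix g h assume "g \<in> {g \<in> Bij (topspace F). homeomorphic_map F F g}"
      "h \<in> {g \<in> Bij (topspace F). homeomorphic_map F F g}"
    moreover from this have "homeomorphic_map F F (compose (topspace F) g h)"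
      by (auto intro!: homeomorphic_map_eq[OF homeomorphic_map_compose[of F F h F g]]
          simp: compose_def)
    ultimately show "g \<otimes>\<^bsub>BijGroup (topspace F)\<^esub> h \<in>
        {g \<in> Bij (topspace F). homeomorphic_map F F g}"
      by (auto simp: BijGroup_def compose_Bij)
  qed
  then show ?thesis
    unfolding Homeo_def by (rule group.subgroup_imp_group[OF group_BijGroup])
qed

lemma Homeo_eval_action:
  shows "g \<in> carrier (Homeo F) \<Longrightarrow> y \<in> topspace F \<Longrightarrow> g y \<in> topspace F"
    and "y \<in> topspace F \<Longrightarrow> \<one>\<^bsub>Homeo F\<^esub> y = y"
    and "g \<in> carrier (Homeo F) \<Longrightarrow> h \<in> carrier (Homeo F) \<Longrightarrow> y \<in> topspace F \<Longrightarrow>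
      (g \<otimes>\<^bsub>Homeo F\<^esub> h) y = g (h y)"
  by (auto simp: Homeo_def BijGroup_def Bij_def bij_betw_def compose_def)

lemmas equiv_E_orbit_rel_Homeo =
  equiv_E_orbit_rel[OF group_Homeo topspace_Homeo_topology]

lemma equiv_assoc_rel_Homeo:
  "equiv (topspace (prod_topology (E_space (Homeo_topology F) I) F))
     (assoc_rel (Homeo F) (Homeo_topology F) I F (\<lambda>g y. g y))"
  by (rule equiv_assoc_rel[OF group_Homeo topspace_Homeo_topology]) (fact Homeo_eval_action)+

lemma assoc_proj_class_Homeo:
  assumes "e \<in> topspace (E_space (Homeo_topology F) I)" "y \<in> topspace F"
  shows "assoc_proj (Homeo F) (Homeo_topology F) I
       (assoc_rel (Homeo F) (Homeo_topology F) I F (\<lambda>g y. g y) `` {(e, y)}) =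
     E_orbit_rel (Homeo F) (Homeo_topology F) I `` {e}"
  by (rule assoc_proj_class[OF group_Homeo topspace_Homeo_topology]) (fact Homeo_eval_action assms)+

end

theory Submission
  imports Defs
begin

text \<open>A bundle is recovered from its transition functions, and these define a map into
  \<open>B\<^sup>\<kappa> G\<close>. Choose trivializations \<open>\<phi>\<^sub>i\<close> over \<open>U\<^sub>i\<close>, indexed by \<open>I\<close> through a bijection with
  the given index set, and let \<open>t\<^sub>i\<^sub>j(b)\<close> be the homeomorphism of \<open>F\<close> that changes the coordinate
  \<open>\<phi>\<^sub>j\<close> into \<open>\<phi>\<^sub>i\<close> on the fibre over \<open>b\<close>. For \<open>b \<in> U\<^sub>j\<close> let \<open>e\<^sub>j(b)\<close> be the point of \<open>E\<^sup>\<kappa> G\<close> with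
  \<open>i\<close>-th coordinate \<open>t\<^sub>i\<^sub>j(b)\<close> if \<open>b \<in> U\<^sub>i\<close> and the cone point otherwise. The cocycle rule
  \<open>t\<^sub>i\<^sub>k = t\<^sub>i\<^sub>j t\<^sub>j\<^sub>k\<close> says \<open>e\<^sub>k(b) = e\<^sub>j(b) t\<^sub>j\<^sub>k(b)\<close>, so the orbit \<open>f(b)\<close> of \<open>e\<^sub>j(b)\<close> and, for \<open>x\<close> in the
  fibre over \<open>b\<close>, the class of \<open>(e\<^sub>j(b), \<phi>\<^sub>j(x))\<close> do not depend on \<open>j\<close>. The second assignment is the
  bundle map that identifies \<open>E\<close> with the pullback.

  Two continuity statements carry the proof. That \<open>e\<^sub>j\<close> is continuous rests on the transition
  functions being continuous into the compact-open topology, which is currying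
  (\<open>continuous_map_curry_compact_open\<close>), and on the topology of the cone: since the whole cone is the
  only neighbourhood of the cone point, a coordinate may jump to that point as \<open>b\<close> leaves \<open>U\<^sub>i\<close>
  (\<open>continuous_map_into_cone\<close>).

  The inverse of the bundle map must read off a point of \<open>F\<close> from a class \<open>[e, y]\<close> lying over
  \<open>f(b)\<close>. As \<open>t\<^sub>j\<^sub>j(b)\<close> is the identity, this point is \<open>e\<^sub>j(y)\<close>: the expression is constant on
  equivalence classes because \<open>(e\<^sub>j g)(y) = e\<^sub>j(g y)\<close>, and on the representative \<open>(e\<^sub>j(b), y')\<close> it
  has the value \<open>y'\<close>. It is continuous because evaluation \<open>Homeo(F) \<times> F \<rightarrow> F\<close> is
  (\<open>continuous_map_eval_compact_open\<close>), and here the local compactness of \<open>F\<close> enters; it descends to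
  the quotient because a quotient map restricts to a quotient map over an open set.\<close>

section \<open>Evaluation and currying for the compact-open topology\<close>

text \<open>Given \<open>g x \<in> V\<close>, local compactness provides a compact neighbourhood \<open>K\<close> of \<open>x\<close> with
  \<open>g(K) \<subseteq> V\<close>; then every \<open>h\<close> in the subbasic open set of \<open>(K, V)\<close> maps the interior of \<open>K\<close> into \<open>V\<close>.\<close>

lemma continuous_map_eval_compact_open:
  fixes X :: "'a topology" and Y :: "'b topology"
  assumes X: "locally_compact_space X" "Hausdorff_space X"
  shows "continuous_map (prod_topology (compact_open_topology X Y) X) Y (\<lambda>(g, x). g x)"
  unfolding continuous_map_def
proof (intro conjI allI impI)
  show "(\<lambda>(g, x). g x) \<in> topspace (prod_topology (compact_open_topology X Y) X) \<rightarrow> topspace Y"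
    by (auto simp: topspace_compact_open_topology continuous_map_def)
next
  fix V assume V: "openin Y V"
  let ?C = "compact_open_topology X Y"
  let ?P = "{z \<in> topspace (prod_topology ?C X). (case z of (g, x) \<Rightarrow> g x) \<in> V}"
  show "openin (prod_topology ?C X) ?P"
  proof (subst openin_prod_topology_alt, intro allI impI)
    fix g x assume "(g, x) \<in> ?P"
    then have g: "g \<in> extensional (topspace X)" "continuous_map X Y g"
      and x: "x \<in> topspace X" "g x \<in> V"
      by (auto simp: topspace_compact_open_topology)
    have "openin X {x \<in> topspace X. g x \<in> V}"
      using openin_continuous_map_preimage[OF g(2) V] .
    moreover have "neighbourhood_base_of (compactin X) X"
      using X locally_compact_space_neighbourhood_base by blast
    ultimately obtain N K where NK: "openin X N" "compactin X K" "x \<in> N" "N \<subseteq> K"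
      "K \<subseteq> {x \<in> topspace X. g x \<in> V}"
      using x unfolding neighbourhood_base_of by (metis (no_types, lifting) mem_Collect_eq)
    let ?S = "{h \<in> extensional (topspace X). continuous_map X Y h \<and> h ` K \<subseteq> V}"
    have "openin ?C ?S"
      unfolding compact_open_topology_def
      by (rule topology_generated_by_Basis) (use NK V in blast)
    moreover have "g \<in> ?S" using g NK by auto
    moreover have "?S \<times> N \<subseteq> ?P"
      using NK openin_subset[OF NK(1)]
      by (auto simp: topspace_compact_open_topology image_subset_iff subset_iff)
    ultimately show "\<exists>S N. openin ?C S \<and> openin X N \<and> g \<in> S \<and> x \<in> N \<and> S \<times> N \<subseteq> ?P"
      using NK by blast
  qed
qed

lemma continuous_map_slice:
  assumes "continuous_map (prod_topology Z X) Y h" "z \<in> topspace Z"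
  shows "continuous_map X Y (\<lambda>x. h (z, x))"
  using continuous_map_compose[OF _ assms(1), of X "\<lambda>x. (z, x)"] assms(2)
  by (auto simp: continuous_map_pairwise o_def)

text \<open>This half of the exponential law is the tube lemma: if the slice over \<open>z\<close> sends a compact \<open>K\<close>
  into \<open>V\<close>, then so do the slices over a neighbourhood of \<open>z\<close>.\<close>

lemma continuous_map_curry_compact_open:
  assumes h: "continuous_map (prod_topology Z X) Y h"
  shows "continuous_map Z (compact_open_topology X Y) (\<lambda>z. \<lambda>x\<in>topspace X. h (z, x))"
  unfolding compact_open_topology_def
proof (rule continuous_on_generated_topo)
  let ?c = "\<lambda>z. \<lambda>x\<in>topspace X. h (z, x)"
  have cont: "continuous_map X Y (?c z)" if "z \<in> topspace Z" for z
    using continuous_map_slice[OF h that] by simp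
  fix S assume "S \<in> {{f \<in> extensional (topspace X). continuous_map X Y f \<and> f ` K \<subseteq> V} | K V.
      compactin X K \<and> openin Y V}"
  then obtain K V where K: "compactin X K" and V: "openin Y V"
    and S: "S = {f \<in> extensional (topspace X). continuous_map X Y f \<and> f ` K \<subseteq> V}"
    by blast
  have KX: "K \<subseteq> topspace X" using K by (rule compactin_subset_topspace)
  let ?W = "{q \<in> topspace (prod_topology Z X). h q \<in> V}"
  have W: "openin (prod_topology Z X) ?W" using openin_continuous_map_preimage[OF h V] .
  show "openin Z (?c -` S \<inter> topspace Z)"
  proof (subst openin_subopen, intro ballI)
    fix z assume "z \<in> ?c -` S \<inter> topspace Z"
    then have z: "z \<in> topspace Z" and "?c z ` K \<subseteq> V" by (auto simp: S)
    then have "{z} \<times> K \<subseteq> ?W" using KX by (auto simp: image_subset_iff)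
    then obtain N M where N: "openin Z N" "z \<in> N" and M: "K \<subseteq> M" and NM: "N \<times> M \<subseteq> ?W"
      using tube_lemma_right[OF W K z] by blast
    have "w \<in> ?c -` S \<inter> topspace Z" if "w \<in> N" for w
    proof -
      have w: "w \<in> topspace Z" using that openin_subset[OF N(1)] by blast
      have "{w} \<times> K \<subseteq> ?W" using that M NM by blast
      then have "?c w ` K \<subseteq> V" using KX by auto
      then show ?thesis using w cont[OF w] by (simp add: S)
    qed
    then show "\<exists>N. openin Z N \<and> z \<in> N \<and> N \<subseteq> ?c -` S \<inter> topspace Z"
      using N by blast
  qed
next
  show "(\<lambda>z. \<lambda>x\<in>topspace X. h (z, x)) ` topspace Z \<subseteq>
    \<Union>{{f \<in> extensional (topspace X). continuous_map X Y f \<and> f ` K \<subseteq> V} | K V.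
      compactin X K \<and> openin Y V}"
    using continuous_map_slice[OF h]
    unfolding topology_generated_by_topspace[symmetric] compact_open_topology_def[symmetric]
      topspace_compact_open_topology by auto
qed

section \<open>Maps into and out of the indiscrete cone\<close>

lemma openin_cone_base: "openin (indiscrete_cone X) (Some ` topspace X)"
  by (auto simp: openin_indiscrete_cone)

lemma continuous_map_the_cone:
  "continuous_map (subtopology (indiscrete_cone X) (Some ` topspace X)) X the"
  unfolding continuous_map_def
proof (intro conjI allI impI)
  show "the \<in> topspace (subtopology (indiscrete_cone X) (Some ` topspace X)) \<rightarrow> topspace X"
    by (auto simp: topspace_indiscrete_cone)
next
  fix U assume U: "openin X U"
  have "{w \<in> topspace (subtopology (indiscrete_cone X) (Some ` topspace X)). the w \<in> U} = Some ` U"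
    using openin_subset[OF U] by (auto simp: topspace_indiscrete_cone)
  moreover have "openin (indiscrete_cone X) (Some ` U)"
    using U by (auto simp: openin_indiscrete_cone)
  ultimately show "openin (subtopology (indiscrete_cone X) (Some ` topspace X))
      {w \<in> topspace (subtopology (indiscrete_cone X) (Some ` topspace X)). the w \<in> U}"
    using openin_subset[OF U]
    by (simp add: openin_open_subtopology[OF openin_cone_base] image_mono)
qed

text \<open>A continuous map on an open set extends by the cone point to the whole space: the preimage of
  an open set that misses the cone point lies inside \<open>W\<close>, and the only other open set is everything.\<close>

lemma continuous_map_into_cone:
  assumes W: "openin Z W" and f: "continuous_map (subtopology Z W) X f"
  shows "continuous_map Z (indiscrete_cone X) (\<lambda>z. if z \<in> W then Some (f z) else None)"
    (is "continuous_map _ _ ?h")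
  unfolding continuous_map_def
proof (intro conjI allI impI)
  have fW: "f z \<in> topspace X" if "z \<in> W" for z
    using that f openin_subset[OF W] by (auto simp: continuous_map_def)
  then show "?h \<in> topspace Z \<rightarrow> topspace (indiscrete_cone X)"
    by (auto simp: topspace_indiscrete_cone)
  fix S assume "openin (indiscrete_cone X) S"
  then consider U where "openin X U" "S = Some ` U" | "S = insert None (Some ` topspace X)"
    by (auto simp: openin_indiscrete_cone)
  then show "openin Z {z \<in> topspace Z. ?h z \<in> S}"
  proof cases
    case 1
    have "{z \<in> topspace Z. ?h z \<in> S} = {z \<in> topspace (subtopology Z W). f z \<in> U}"
      using 1 by auto
    then show ?thesis
      using openin_continuous_map_preimage[OF f 1(1)] W by (simp add: openin_open_subtopology)
  next
    case 2
    then have "{z \<in> topspace Z. ?h z \<in> S} = topspace Z" using fW by auto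
    then show ?thesis by simp
  qed
qed

section \<open>Fibre coordinates on the associated bundle\<close>

abbreviation EG :: "'f topology \<Rightarrow> 'i set \<Rightarrow> ('i \<Rightarrow> ('f \<Rightarrow> 'f) option) topology" where
  "EG F I \<equiv> E_space (Homeo_topology F) I"

abbreviation orbit_rel where
  "orbit_rel F I \<equiv> E_orbit_rel (Homeo F) (Homeo_topology F) I"

abbreviation BG where
  "BG F I \<equiv> B_space (Homeo F) (Homeo_topology F) I"

abbreviation fibre_rel where
  "fibre_rel F I \<equiv> assoc_rel (Homeo F) (Homeo_topology F) I F (\<lambda>g y. g y)"

abbreviation EGF where
  "EGF F I \<equiv> assoc_space (Homeo F) (Homeo_topology F) I F (\<lambda>g y. g y)"

abbreviation EGF_proj where
  "EGF_proj F I \<equiv> assoc_proj (Homeo F) (Homeo_topology F) I"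

lemmas E_act_closed_Homeo = E_act_closed[OF group_Homeo topspace_Homeo_topology]

lemma fibre_rel_iff:
  "((d, x), (e, y)) \<in> fibre_rel F I \<longleftrightarrow>
     d \<in> topspace (EG F I) \<and> e \<in> topspace (EG F I) \<and> x \<in> topspace F \<and>
     (\<exists>g\<in>carrier (Homeo F). d = E_act (Homeo F) I e g \<and> y = g x)"
  by (rule assoc_rel_iff[OF group_Homeo topspace_Homeo_topology]) (fact Homeo_eval_action)+

lemma quotient_map_BG: "quotient_map (EG F I) (BG F I) (\<lambda>e. orbit_rel F I `` {e})"
  unfolding B_space_def by (rule quotient_map_quotient_space)

lemma quotient_map_EGF:
  "quotient_map (prod_topology (EG F I) F) (EGF F I) (\<lambda>z. fibre_rel F I `` {z})"
  unfolding assoc_space_def by (rule quotient_map_quotient_space)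

lemma orbit_eqI:
  assumes "e \<in> topspace (EG F I)" "g \<in> carrier (Homeo F)"
  shows "orbit_rel F I `` {E_act (Homeo F) I e g} = orbit_rel F I `` {e}"
proof -
  have "(e, E_act (Homeo F) I e g) \<in> orbit_rel F I"
    using assms by (auto simp: E_orbit_rel_def)
  then show ?thesis using equiv_class_eq[OF equiv_E_orbit_rel_Homeo] by blast
qed

lemma fibre_class_eqI:
  assumes "e \<in> topspace (EG F I)" "g \<in> carrier (Homeo F)" "y \<in> topspace F"
  shows "fibre_rel F I `` {(E_act (Homeo F) I e g, y)} = fibre_rel F I `` {(e, g y)}"
proof -
  have "((E_act (Homeo F) I e g, y), (e, g y)) \<in> fibre_rel F I"
    using assms by (auto simp: fibre_rel_iff E_act_closed_Homeo)
  then show ?thesis using equiv_class_eq[OF equiv_assoc_rel_Homeo] by blast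
qed

lemma fibre_class_cases:
  assumes "C \<in> topspace (EGF F I)"
  obtains e y where "e \<in> topspace (EG F I)" "y \<in> topspace F" "C = fibre_rel F I `` {(e, y)}"
  using assms by (auto simp: assoc_space_def topspace_quotient_space elim!: quotientE)

lemma fibre_class_in:
  assumes "e \<in> topspace (EG F I)" "y \<in> topspace F"
  shows "fibre_rel F I `` {(e, y)} \<in> topspace (EGF F I)"
  using assms by (auto simp: assoc_space_def topspace_quotient_space intro!: quotientI)

lemma EGF_proj_class:
  assumes "e \<in> topspace (EG F I)" "y \<in> topspace F"
  shows "EGF_proj F I (fibre_rel F I `` {(e, y)}) = orbit_rel F I `` {e}"
  using assms by (rule assoc_proj_class_Homeo)

lemma EG_component:
  assumes "e \<in> topspace (EG F I)" "j \<in> I" "e j = Some g"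
  shows "g \<in> carrier (Homeo F)"
proof -
  have "e \<in> I \<rightarrow>\<^sub>E insert None (Some ` carrier (Homeo F))"
    using assms(1) by (auto simp: topspace_E_space topspace_Homeo_topology)
  then have "e j \<in> insert None (Some ` carrier (Homeo F))" using assms(2) by blast
  then show ?thesis using assms(3) by auto
qed

definition coord_domain ::
    "'f topology \<Rightarrow> 'i set \<Rightarrow> 'i \<Rightarrow> (('i \<Rightarrow> ('f \<Rightarrow> 'f) option) \<times> 'f) set set" where
  "coord_domain F I j =
     {fibre_rel F I `` {(e, y)} | e y. e \<in> topspace (EG F I) \<and> y \<in> topspace F \<and> e j \<noteq> None}"

text \<open>The \<open>j\<close>-th fibre coordinate of a class in \<open>coord_domain F I j\<close>. The image is then a singleton,
  since \<open>(e\<^sub>j g)(y) = e\<^sub>j(g y)\<close>; outside that domain the value carries no information.\<close>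

definition assoc_coord :: "'i \<Rightarrow> (('i \<Rightarrow> ('f \<Rightarrow> 'f) option) \<times> 'f) set \<Rightarrow> 'f" where
  "assoc_coord j C = the_elem ((\<lambda>(e, y). the (e j) y) ` C)"

lemma fibre_rel_component:
  assumes "((d, x), (e, y)) \<in> fibre_rel F I" "j \<in> I"
  shows "d j = None \<longleftrightarrow> e j = None"
    and "d j \<noteq> None \<Longrightarrow> the (d j) x = the (e j) y"
proof -
  obtain g where g: "e \<in> topspace (EG F I)" "x \<in> topspace F" "g \<in> carrier (Homeo F)"
      "d = E_act (Homeo F) I e g" "y = g x"
    using assms(1) by (auto simp: fibre_rel_iff)
  then show None: "d j = None \<longleftrightarrow> e j = None" using assms(2) by (simp add: E_act_def)
  assume "d j \<noteq> None"
  then obtain a where a: "e j = Some a" using None by auto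
  then have "d j = Some (a \<otimes>\<^bsub>Homeo F\<^esub> g)" using g assms(2) by (simp add: E_act_def)
  moreover have "a \<in> carrier (Homeo F)" using EG_component[OF g(1) assms(2) a] .
  ultimately show "the (d j) x = the (e j) y"
    using a g by (simp add: Homeo_eval_action)
qed

lemma fibre_class_self:
  assumes "e \<in> topspace (EG F I)" "y \<in> topspace F"
  shows "(e, y) \<in> fibre_rel F I `` {(e, y)}"
  using equiv_class_self[OF equiv_assoc_rel_Homeo, of "(e, y)"] assms by auto

lemma fibre_class_in_coord_domain_iff:
  assumes "e \<in> topspace (EG F I)" "y \<in> topspace F" "j \<in> I"
  shows "fibre_rel F I `` {(e, y)} \<in> coord_domain F I j \<longleftrightarrow> e j \<noteq> None"
proof
  assume "fibre_rel F I `` {(e, y)} \<in> coord_domain F I j"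
  then obtain d x where d: "d \<in> topspace (EG F I)" "x \<in> topspace F" "d j \<noteq> None"
    and eq: "fibre_rel F I `` {(e, y)} = fibre_rel F I `` {(d, x)}"
    by (auto simp: coord_domain_def)
  have "((d, x), (e, y)) \<in> fibre_rel F I"
    using fibre_class_self[OF assms(1,2)] by (simp only: eq Image_singleton_iff)
  then show "e j \<noteq> None" using fibre_rel_component(1) assms(3) d(3) by metis
qed (use assms in \<open>auto simp: coord_domain_def\<close>)

lemma assoc_coord_class:
  assumes e: "e \<in> topspace (EG F I)" and y: "y \<in> topspace F" and j: "j \<in> I" "e j = Some g"
  shows "assoc_coord j (fibre_rel F I `` {(e, y)}) = g y"
proof -
  have "the (d j) x = g y" if "(d, x) \<in> fibre_rel F I `` {(e, y)}" for d x
    using fibre_rel_component[of e y d x F I j] that j by simp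
  then have "(\<lambda>(d, x). the (d j) x) ` (fibre_rel F I `` {(e, y)}) = {g y}"
    using fibre_class_self[OF e y] by (force simp del: Image_singleton_iff)
  then show ?thesis by (simp add: assoc_coord_def)
qed

lemma continuous_map_EG_component:
  assumes "j \<in> I"
  shows "continuous_map (EG F I) (indiscrete_cone (Homeo_topology F)) (\<lambda>e. e j)"
  using assms unfolding E_space_def Let_def
  by (intro continuous_map_from_subtopology continuous_map_product_projection)

text \<open>Before passing to classes the coordinate is \<open>(e, y) \<mapsto> e\<^sub>j(y)\<close>, a composite with the evaluation
  map. It is defined on an open saturated subset of \<open>E\<^sup>\<kappa> G \<times> F\<close>, and over such a subset the
  projection to classes is still a quotient map, so continuity descends.\<close>

lemma continuous_map_assoc_coord:
  assumes F: "locally_compact_space F" "Hausdorff_space F" and j: "j \<in> I"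
  shows "continuous_map (subtopology (EGF F I) (coord_domain F I j)) F (assoc_coord j)"
proof -
  let ?X = "prod_topology (EG F I) F" and ?q = "\<lambda>z. fibre_rel F I `` {z}"
  let ?D = "{z \<in> topspace ?X. ?q z \<in> coord_domain F I j}"
  let ?H = "Homeo_topology F"
  have comp: "continuous_map ?X (indiscrete_cone ?H) (\<lambda>z. fst z j)"
    using continuous_map_compose[OF continuous_map_fst continuous_map_EG_component[OF j]]
    by (simp add: o_def)
  have in_D: "z \<in> ?D \<longleftrightarrow> z \<in> topspace ?X \<and> fst z j \<in> Some ` topspace ?H" for z
    using j EG_component[of "fst z" F I j]
    by (cases z) (auto simp: fibre_class_in_coord_domain_iff topspace_Homeo_topology)
  have D: "?D = {z \<in> topspace ?X. fst z j \<in> Some ` topspace ?H}"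
    using in_D by blast
  have "openin ?X ?D"
    unfolding D by (rule openin_continuous_map_preimage[OF comp openin_cone_base])
  moreover have "coord_domain F I j \<subseteq> topspace (EGF F I)"
    by (auto simp: coord_domain_def intro: fibre_class_in)
  ultimately have op: "openin (EGF F I) (coord_domain F I j)"
    using quotient_map_EGF[of F I] unfolding quotient_map_def by blast
  have q: "quotient_map (subtopology ?X ?D) (subtopology (EGF F I) (coord_domain F I j)) ?q"
    using quotient_map_restriction[OF quotient_map_EGF refl] op by blast
  have eval: "continuous_map (prod_topology ?H F) F (\<lambda>(g, x). g x)"
    unfolding Homeo_topology_def prod_topology_subtopology
    by (intro continuous_map_from_subtopology continuous_map_eval_compact_open F)
  \<comment> \<open>On \<open>?D\<close> the component \<open>e j\<close> avoids the cone point, so it is a homeomorphism of \<open>F\<close>.\<close>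
  have "continuous_map (subtopology ?X ?D) (subtopology (indiscrete_cone ?H) (Some ` topspace ?H))
      (\<lambda>z. fst z j)"
    using continuous_map_from_subtopology[OF comp] in_D
    by (auto simp: continuous_map_in_subtopology)
  from continuous_map_compose[OF this continuous_map_the_cone]
  have "continuous_map (subtopology ?X ?D) ?H (\<lambda>z. the (fst z j))"
    by (simp add: o_def)
  moreover have "continuous_map (subtopology ?X ?D) F snd"
    by (intro continuous_map_from_subtopology continuous_map_snd)
  ultimately have "continuous_map (subtopology ?X ?D) (prod_topology ?H F)
      (\<lambda>z. (the (fst z j), snd z))"
    by (intro continuous_map_pairedI)
  from continuous_map_compose[OF this eval]
  have "continuous_map (subtopology ?X ?D) F (\<lambda>z. the (fst z j) (snd z))"
    by (simp add: o_def)
  moreover have "the (fst z j) (snd z) = (assoc_coord j \<circ> ?q) z"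
    if "z \<in> topspace (subtopology ?X ?D)" for z
    using that in_D[of z] assoc_coord_class[OF _ _ j, of "fst z" F "snd z"] by (cases z) auto
  ultimately have "continuous_map (subtopology ?X ?D) F (assoc_coord j \<circ> ?q)"
    by (rule continuous_map_eq)
  then show "continuous_map (subtopology (EGF F I) (coord_domain F I j)) F (assoc_coord j)"
    using continuous_compose_quotient_map[OF q] by blast
qed

section \<open>Transition functions and the classifying map\<close>

text \<open>A bundle with chosen trivializations \<open>\<phi> i\<close> over the sets \<open>U i\<close> and chosen inverses \<open>\<psi> i\<close>, so that
  the transition functions and the classifying map become definite objects.\<close>

locale bundle_atlas =
  fixes F :: "'f topology" and E :: "'e topology" and B :: "'b topology"
    and p :: "'e \<Rightarrow> 'b" and I :: "'i set" and U :: "'i \<Rightarrow> 'b set"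
    and \<phi> :: "'i \<Rightarrow> 'e \<Rightarrow> 'b \<times> 'f" and \<psi> :: "'i \<Rightarrow> 'b \<times> 'f \<Rightarrow> 'e"
  assumes continuous_proj: "continuous_map E B p"
    and open_U: "i \<in> I \<Longrightarrow> openin B (U i)"
    and cover: "(\<Union>i\<in>I. U i) = topspace B"
    and charts: "i \<in> I \<Longrightarrow> homeomorphic_maps (subtopology E {x \<in> topspace E. p x \<in> U i})
          (prod_topology (subtopology B (U i)) F) (\<phi> i) (\<psi> i)"
    and fst_chart: "i \<in> I \<Longrightarrow> x \<in> topspace E \<Longrightarrow> p x \<in> U i \<Longrightarrow> fst (\<phi> i x) = p x"
begin

abbreviation over :: "'i \<Rightarrow> 'e set" where
  "over i \<equiv> {x \<in> topspace E. p x \<in> U i}"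

text \<open>The restriction to \<open>topspace F\<close> makes the value an extensional function, as the elements of
  \<open>Homeo F\<close> are.\<close>

definition transition :: "'i \<Rightarrow> 'i \<Rightarrow> 'b \<Rightarrow> 'f \<Rightarrow> 'f" where
  "transition i j b = (\<lambda>y\<in>topspace F. snd (\<phi> i (\<psi> j (b, y))))"

text \<open>The \<open>j\<close>-th column of the transition cocycle at \<open>b\<close>. For \<open>j \<in> I\<close> and \<open>b \<in> U j\<close> it is a point of \<open>E\<^sup>\<kappa> G\<close>: its
  \<open>j\<close>-th coordinate is then not the cone point.\<close>

definition frame :: "'i \<Rightarrow> 'b \<Rightarrow> 'i \<Rightarrow> ('f \<Rightarrow> 'f) option" where
  "frame j b = (\<lambda>i\<in>I. if b \<in> U i then Some (transition i j b) else None)"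

definition chart_at :: "'b \<Rightarrow> 'i" where
  "chart_at b = (SOME i. i \<in> I \<and> b \<in> U i)"

definition classifying_map :: "'b \<Rightarrow> ('i \<Rightarrow> ('f \<Rightarrow> 'f) option) set" where
  "classifying_map b = orbit_rel F I `` {frame (chart_at b) b}"

text \<open>The total-space component of the bundle map covering \<open>classifying_map\<close>; the chart in its
  definition is an arbitrary one, see \<open>bundle_map_eq\<close>.\<close>

definition bundle_map :: "'e \<Rightarrow> (('i \<Rightarrow> ('f \<Rightarrow> 'f) option) \<times> 'f) set" where
  "bundle_map x =
     fibre_rel F I `` {(frame (chart_at (p x)) (p x), snd (\<phi> (chart_at (p x)) x))}"

lemma chart_at:
  assumes "b \<in> topspace B"
  shows "chart_at b \<in> I" "b \<in> U (chart_at b)"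
proof -
  have "\<exists>i. i \<in> I \<and> b \<in> U i" using assms cover by blast
  from someI_ex[OF this] show "chart_at b \<in> I" "b \<in> U (chart_at b)"
    by (simp_all add: chart_at_def)
qed

lemma U_subset: "i \<in> I \<Longrightarrow> U i \<subseteq> topspace B"
  using open_U openin_subset by blast

lemma proj_in: "x \<in> topspace E \<Longrightarrow> p x \<in> topspace B"
  using continuous_proj by (auto simp: continuous_map_def)

lemma openin_over: "i \<in> I \<Longrightarrow> openin E (over i)"
  using openin_continuous_map_preimage[OF continuous_proj open_U] .

lemma chart_inverse:
  assumes i: "i \<in> I" "b \<in> U i" "y \<in> topspace F"
  shows "\<psi> i (b, y) \<in> topspace E" "p (\<psi> i (b, y)) = b" "\<phi> i (\<psi> i (b, y)) = (b, y)"
proof -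
  have dom: "(b, y) \<in> topspace (prod_topology (subtopology B (U i)) F)"
    using assms U_subset by auto
  then have "\<psi> i (b, y) \<in> over i"
    using charts[OF i(1)] by (auto simp: homeomorphic_maps_def continuous_map_def Pi_iff)
  moreover show \<phi>: "\<phi> i (\<psi> i (b, y)) = (b, y)"
    using charts[OF i(1)] dom by (simp add: homeomorphic_maps_def)
  ultimately show "\<psi> i (b, y) \<in> topspace E" "p (\<psi> i (b, y)) = b"
    using fst_chart[OF i(1), of "\<psi> i (b, y)"] by auto
qed

lemma chart_coord:
  assumes i: "i \<in> I" "x \<in> topspace E" "p x \<in> U i"
  shows "snd (\<phi> i x) \<in> topspace F" "\<psi> i (p x, snd (\<phi> i x)) = x"
proof -
  have x: "x \<in> topspace (subtopology E (over i))" using assms by auto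
  then have "\<phi> i x \<in> topspace (prod_topology (subtopology B (U i)) F)"
    using charts[OF i(1)] by (auto simp: homeomorphic_maps_def continuous_map_def Pi_iff)
  then show "snd (\<phi> i x) \<in> topspace F" by (cases "\<phi> i x") auto
  have "(p x, snd (\<phi> i x)) = \<phi> i x" using fst_chart[OF assms] by (cases "\<phi> i x") auto
  then show "\<psi> i (p x, snd (\<phi> i x)) = x"
    using charts[OF i(1)] x by (simp add: homeomorphic_maps_def)
qed

lemma continuous_map_chart_coord:
  assumes i: "i \<in> I"
  shows "continuous_map (subtopology E (over i)) F (\<lambda>x. snd (\<phi> i x))"
  using charts[OF i] continuous_map_snd
  by (auto simp: homeomorphic_maps_def intro: continuous_map_compose[unfolded o_def])

lemma transition_coord:
  assumes "i \<in> I" "j \<in> I" "x \<in> topspace E" "p x \<in> U i" "p x \<in> U j"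
  shows "transition i j (p x) (snd (\<phi> j x)) = snd (\<phi> i x)"
  using assms chart_coord[of j x] by (simp add: transition_def)

lemma transition_closed:
  assumes "i \<in> I" "j \<in> I" "b \<in> U i" "b \<in> U j" "y \<in> topspace F"
  shows "transition i j b y \<in> topspace F"
  using assms chart_inverse[of j b y] chart_coord(1)[of i "\<psi> j (b, y)"]
  by (simp add: transition_def)

lemma transition_cocycle:
  assumes "i \<in> I" "j \<in> I" "k \<in> I" "b \<in> U i" "b \<in> U j" "b \<in> U k" "y \<in> topspace F"
  shows "transition i j b (transition j k b y) = transition i k b y"
proof -
  let ?x = "\<psi> k (b, y)"
  have x: "?x \<in> topspace E" "p ?x = b" "snd (\<phi> k ?x) = y"
    using chart_inverse[of k b y] assms by auto
  then show ?thesis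
    using transition_coord[of j k ?x] transition_coord[of i k ?x] transition_coord[of i j ?x] assms
    by simp
qed

lemma transition_self:
  assumes "i \<in> I" "b \<in> U i" "y \<in> topspace F"
  shows "transition i i b y = y"
  using assms chart_inverse[of i b y] by (simp add: transition_def)

lemma continuous_map_transition_joint:
  assumes i: "i \<in> I" and j: "j \<in> I"
  shows "continuous_map (prod_topology (subtopology B (U i \<inter> U j)) F) F
           (\<lambda>z. snd (\<phi> i (\<psi> j z)))"
proof -
  let ?Z = "prod_topology (subtopology B (U i \<inter> U j)) F"
  have "continuous_map (prod_topology (subtopology B (U j)) F) E (\<psi> j)"
    using charts[OF j] by (auto simp: homeomorphic_maps_def continuous_map_in_subtopology)
  moreover have "?Z = subtopology (prod_topology (subtopology B (U j)) F) (U i \<times> topspace F)"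
    by (simp add: subtopology_subtopology subtopology_Times Int_commute)
  ultimately have "continuous_map ?Z E (\<psi> j)"
    by (simp add: continuous_map_from_subtopology)
  then have "continuous_map ?Z (subtopology E (over i)) (\<psi> j)"
    using chart_inverse[OF j] by (auto simp: continuous_map_in_subtopology)
  from continuous_map_compose[OF this continuous_map_chart_coord[OF i]]
  show ?thesis by (simp add: o_def)
qed

lemma transition_in_Homeo:
  assumes i: "i \<in> I" and j: "j \<in> I" and b: "b \<in> U i" "b \<in> U j"
  shows "transition i j b \<in> carrier (Homeo F)"
proof -
  have cont: "continuous_map F F (transition k l b)"
    if "k \<in> I" "l \<in> I" "b \<in> U k" "b \<in> U l" for k l
  proof -
    have "b \<in> topspace (subtopology B (U k \<inter> U l))" using that U_subset by auto
    from continuous_map_slice[OF continuous_map_transition_joint this] that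
    show ?thesis by (simp add: transition_def)
  qed
  have "homeomorphic_maps F F (transition i j b) (transition j i b)"
    using assms by (auto simp: homeomorphic_maps_def cont transition_cocycle transition_self)
  then show ?thesis
    by (auto simp: carrier_Homeo homeomorphic_map_maps transition_def)
qed

text \<open>Charts give continuity jointly in \<open>b\<close> and \<open>y\<close>; currying turns it into continuity of
  \<open>b \<mapsto> t\<^sub>i\<^sub>j(b)\<close> for the compact-open topology.\<close>

lemma continuous_map_transition:
  assumes i: "i \<in> I" and j: "j \<in> I"
  shows "continuous_map (subtopology B (U i \<inter> U j)) (Homeo_topology F) (transition i j)"
proof -
  have "continuous_map (subtopology B (U i \<inter> U j)) (compact_open_topology F F) (transition i j)"
    using continuous_map_curry_compact_open[OF continuous_map_transition_joint[OF assms]]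
    unfolding transition_def[abs_def] .
  then show ?thesis
    using transition_in_Homeo[OF assms]
    by (auto simp: Homeo_topology_def continuous_map_in_subtopology)
qed

text \<open>Coordinatewise, each \<open>t\<^sub>i\<^sub>j\<close> is continuous on the open subset \<open>U i \<inter> U j\<close> of \<open>U j\<close> and takes the
  cone point on the rest, where the cone topology imposes no condition.\<close>

lemma continuous_map_frame:
  assumes j: "j \<in> I"
  shows "continuous_map (subtopology B (U j)) (EG F I) (frame j)"
proof -
  let ?Z = "subtopology B (U j)" and ?C = "\<lambda>_. indiscrete_cone (Homeo_topology F)"
  have comp: "continuous_map ?Z (?C i) (\<lambda>b. frame j b i)" if i: "i \<in> I" for i
  proof -
    have "openin ?Z (U j \<inter> U i)" using open_U[OF i] by (rule openin_subtopology_Int2)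
    moreover have "continuous_map (subtopology ?Z (U j \<inter> U i)) (Homeo_topology F) (transition i j)"
      using continuous_map_transition[OF i j] by (simp add: subtopology_subtopology Int_ac)
    ultimately have "continuous_map ?Z (?C i)
        (\<lambda>b. if b \<in> U j \<inter> U i then Some (transition i j b) else None)"
      by (rule continuous_map_into_cone)
    then show ?thesis
      by (rule continuous_map_eq) (use i in \<open>auto simp: frame_def\<close>)
  qed
  have "frame j ` topspace ?Z \<subseteq> extensional I" by (auto simp: frame_def)
  then have "continuous_map ?Z (product_topology ?C I) (frame j)"
    using comp by (simp add: continuous_map_componentwise)
  moreover have "frame j b \<noteq> (\<lambda>i\<in>I. None)" if "b \<in> U j" for b
  proof
    assume "frame j b = (\<lambda>i\<in>I. None)"
    then have "frame j b j = None" using j by simp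
    then show False using j that by (simp add: frame_def)
  qed
  moreover have "frame j b \<in> topspace (product_topology ?C I)" if "b \<in> topspace ?Z" for b
    using calculation(1) that by (meson continuous_map_image_subset_topspace image_subset_iff)
  ultimately show ?thesis
    unfolding E_space_def Let_def
    by (simp add: continuous_map_in_subtopology Pi_iff)
qed

lemma frame_in: "j \<in> I \<Longrightarrow> b \<in> U j \<Longrightarrow> frame j b \<in> topspace (EG F I)"
  using continuous_map_funspace[OF continuous_map_frame, of j] U_subset[of j] by (auto simp: Pi_iff)

text \<open>The cocycle rule. Frames at \<open>b\<close> for different charts lie in one orbit, which makes
  \<open>classifying_map\<close> and \<open>bundle_map\<close> independent of the chosen chart.\<close>

lemma frame_change:
  assumes j: "j \<in> I" and k: "k \<in> I" and b: "b \<in> U j" "b \<in> U k"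
  shows "frame k b = E_act (Homeo F) I (frame j b) (transition j k b)"
proof
  fix i
  show "frame k b i = E_act (Homeo F) I (frame j b) (transition j k b) i"
  \<comment> \<open>Where \<open>b\<close> lies outside \<open>U i\<close> both sides are the cone point, which the action fixes; for \<open>i \<notin> I\<close> both are undefined.\<close>
  proof (cases "i \<in> I \<and> b \<in> U i")
    case True
    then have i: "i \<in> I" "b \<in> U i" by auto
    have "transition i j b \<otimes>\<^bsub>Homeo F\<^esub> transition j k b = transition i k b" (is "?l = ?r")
    proof (rule extensionalityI)
      have H: "transition i j b \<in> carrier (Homeo F)" "transition j k b \<in> carrier (Homeo F)"
        using assms i by (auto intro: transition_in_Homeo)
      show "?l \<in> extensional (topspace F)"
        using monoid.m_closed[OF group.is_monoid[OF group_Homeo] H] by (simp add: carrier_Homeo)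
      show "?r \<in> extensional (topspace F)" by (simp add: transition_def)
      show "?l y = ?r y" if "y \<in> topspace F" for y
        using that assms i H by (simp add: Homeo_eval_action transition_cocycle)
    qed
    then show ?thesis using i by (simp add: frame_def E_act_def)
  qed (auto simp: frame_def E_act_def)
qed

lemma classifying_map_eq:
  assumes "j \<in> I" "b \<in> U j"
  shows "classifying_map b = orbit_rel F I `` {frame j b}"
proof -
  have "b \<in> topspace B" using assms U_subset by blast
  note c = chart_at[OF this]
  show ?thesis
    unfolding classifying_map_def frame_change[OF assms(1) c(1) assms(2) c(2)]
    using assms c by (intro orbit_eqI frame_in transition_in_Homeo)
qed

lemma bundle_map_eq:
  assumes j: "j \<in> I" and x: "x \<in> topspace E" "p x \<in> U j"
  shows "bundle_map x = fibre_rel F I `` {(frame j (p x), snd (\<phi> j x))}"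
proof -
  note c = chart_at[OF proj_in[OF x(1)]]
  show ?thesis
    unfolding bundle_map_def frame_change[OF j c(1) x(2) c(2)]
    using assms c
    by (subst fibre_class_eqI)
      (auto intro: frame_in transition_in_Homeo chart_coord simp: transition_coord)
qed

lemma continuous_map_classifying_map: "continuous_map B (BG F I) classifying_map"
proof (rule pasting_lemma[where I = I and T = U and f = "\<lambda>j b. orbit_rel F I `` {frame j b}"])
  show "continuous_map (subtopology B (U j)) (BG F I) (\<lambda>b. orbit_rel F I `` {frame j b})"
    if "j \<in> I" for j
    using continuous_map_compose[OF continuous_map_frame[OF that]
        quotient_imp_continuous_map[OF quotient_map_BG]]
    by (simp add: o_def)
  show "\<exists>j. j \<in> I \<and> b \<in> U j \<and> classifying_map b = orbit_rel F I `` {frame j b}"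
    if "b \<in> topspace B" for b
    using chart_at[OF that] classifying_map_eq by blast
qed (auto simp: open_U classifying_map_eq[symmetric])

lemma continuous_map_bundle_map: "continuous_map E (EGF F I) bundle_map"
proof (rule pasting_lemma[where I = I and T = over
      and f = "\<lambda>j x. fibre_rel F I `` {(frame j (p x), snd (\<phi> j x))}"])
  fix j assume j: "j \<in> I"
  let ?X = "subtopology E (over j)"
  have "continuous_map ?X (subtopology B (U j)) p"
    using continuous_map_from_subtopology[OF continuous_proj]
    by (auto simp: continuous_map_in_subtopology)
  from continuous_map_compose[OF this continuous_map_frame[OF j]]
  have "continuous_map ?X (prod_topology (EG F I) F) (\<lambda>x. (frame j (p x), snd (\<phi> j x)))"
    using continuous_map_chart_coord[OF j] by (intro continuous_map_pairedI) (simp_all add: o_def)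
  from continuous_map_compose[OF this quotient_imp_continuous_map[OF quotient_map_EGF]]
  show "continuous_map ?X (EGF F I) (\<lambda>x. fibre_rel F I `` {(frame j (p x), snd (\<phi> j x))})"
    by (simp add: o_def)
next
  show "\<exists>j. j \<in> I \<and> x \<in> over j \<and>
      bundle_map x = fibre_rel F I `` {(frame j (p x), snd (\<phi> j x))}"
    if "x \<in> topspace E" for x
    using chart_at[OF proj_in[OF that]] that bundle_map_eq by blast
qed (auto simp: openin_over bundle_map_eq[symmetric])

section \<open>The bundle as a pullback\<close>

abbreviation pulled_back :: "('b \<times> (('i \<Rightarrow> ('f \<Rightarrow> 'f) option) \<times> 'f) set) topology" where
  "pulled_back \<equiv> pullback_space B classifying_map (EGF F I) (EGF_proj F I)"

lemma topspace_pulled_back: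
  "topspace pulled_back =
     {(b, C). b \<in> topspace B \<and> C \<in> topspace (EGF F I) \<and> classifying_map b = EGF_proj F I C}"
  by (auto simp: pullback_space_def)

lemma frame_self:
  assumes "j \<in> I" "b \<in> U j"
  shows "frame j b j = Some (transition j j b)"
  using assms by (simp add: frame_def)

text \<open>A class over \<open>f(b)\<close> is represented by some \<open>(e, y)\<close> with \<open>e = e\<^sub>j(b) g\<close>, hence also by
  \<open>(e\<^sub>j(b), g y)\<close>. Because the \<open>j\<close>-th entry of \<open>e\<^sub>j(b)\<close> is the identity of \<open>F\<close>, the coordinate
  \<open>assoc_coord j\<close> recovers \<open>g y\<close>.\<close>

lemma pulled_back_normal_form:
  assumes bC: "(b, C) \<in> topspace pulled_back" and j: "j \<in> I" "b \<in> U j"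
  shows "C \<in> coord_domain F I j" "assoc_coord j C \<in> topspace F"
    "C = fibre_rel F I `` {(frame j b, assoc_coord j C)}"
proof -
  have C_in: "C \<in> topspace (EGF F I)" and fC: "classifying_map b = EGF_proj F I C"
    using bC by (auto simp: topspace_pulled_back)
  obtain e y where e: "e \<in> topspace (EG F I)" and y: "y \<in> topspace F"
    and C: "C = fibre_rel F I `` {(e, y)}"
    using C_in by (rule fibre_class_cases)
  have fr: "frame j b \<in> topspace (EG F I)" using frame_in[OF j] .
  have "orbit_rel F I `` {frame j b} = orbit_rel F I `` {e}"
    using fC classifying_map_eq[OF j] EGF_proj_class[OF e y] C by simp
  then have "(frame j b, e) \<in> orbit_rel F I"
    using equiv_class_self[OF equiv_E_orbit_rel_Homeo e] by blast
  then obtain g where g: "g \<in> carrier (Homeo F)" "e = E_act (Homeo F) I (frame j b) g"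
    by (auto simp: E_orbit_rel_def)
  have gy: "g y \<in> topspace F" using g y by (simp add: Homeo_eval_action)
  have C': "C = fibre_rel F I `` {(frame j b, g y)}"
    using fibre_class_eqI[OF fr g(1) y] C g(2) by simp
  then have "assoc_coord j C = g y"
    using assoc_coord_class[OF fr gy j(1) frame_self[OF j]] transition_self[OF j gy] by simp
  then show "assoc_coord j C \<in> topspace F" "C = fibre_rel F I `` {(frame j b, assoc_coord j C)}"
    using gy C' by simp_all
  show "C \<in> coord_domain F I j"
    unfolding C' using fibre_class_in_coord_domain_iff[OF fr gy j(1)] frame_self[OF j] by simp
qed

lemma assoc_coord_bundle_map:
  assumes "j \<in> I" "x \<in> topspace E" "p x \<in> U j"
  shows "assoc_coord j (bundle_map x) = snd (\<phi> j x)"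
  using assms assoc_coord_class[OF frame_in _ _ frame_self, of j "p x" "snd (\<phi> j x)"]
  by (simp add: bundle_map_eq chart_coord transition_self)

lemma bundle_map_in_pulled_back:
  assumes x: "x \<in> topspace E"
  shows "(p x, bundle_map x) \<in> topspace pulled_back"
proof -
  note c = chart_at[OF proj_in[OF x]]
  have "bundle_map x \<in> topspace (EGF F I)"
    using continuous_map_funspace[OF continuous_map_bundle_map] x by blast
  moreover have "EGF_proj F I (bundle_map x) = classifying_map (p x)"
    using c x by (simp add: bundle_map_eq[OF c(1) x c(2)] classifying_map_eq[OF c]
        EGF_proj_class frame_in chart_coord)
  ultimately show ?thesis using proj_in[OF x] by (simp add: topspace_pulled_back)
qed

lemma bundle_map_section:
  assumes "(b, C) \<in> topspace pulled_back" "j \<in> I" "b \<in> U j"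
  shows "\<psi> j (b, assoc_coord j C) \<in> topspace E" "p (\<psi> j (b, assoc_coord j C)) = b"
    "bundle_map (\<psi> j (b, assoc_coord j C)) = C"
proof -
  note n = pulled_back_normal_form[OF assms]
  note c = chart_inverse[OF assms(2,3) n(2)]
  show "\<psi> j (b, assoc_coord j C) \<in> topspace E" "p (\<psi> j (b, assoc_coord j C)) = b"
    using c by auto
  show "bundle_map (\<psi> j (b, assoc_coord j C)) = C"
    using bundle_map_eq[OF assms(2), of "\<psi> j (b, assoc_coord j C)"] c n(3) assms(3) by simp
qed

lemma bundle_map_retract:
  assumes "j \<in> I" "x \<in> topspace E" "p x \<in> U j"
  shows "\<psi> j (p x, assoc_coord j (bundle_map x)) = x"
  using assms by (simp add: assoc_coord_bundle_map chart_coord)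

text \<open>Over \<open>U j\<close> the inverse of the bundle map is \<open>(b, C) \<mapsto> \<psi> j (b, assoc_coord j C)\<close>. Each of these
  local maps is a two-sided inverse of the bundle map over \<open>U j\<close>, so they agree on overlaps and
  paste to a continuous global inverse.\<close>

lemma isomorphic_pullback_classifying_map:
  assumes F: "locally_compact_space F" "Hausdorff_space F"
  shows "isomorphic_over B E p pulled_back fst"
proof -
  let ?h = "\<lambda>x. (p x, bundle_map x)"
  let ?s = "\<lambda>j (b, C). \<psi> j (b, assoc_coord j C)"
  let ?k = "\<lambda>z. ?s (chart_at (fst z)) z"
  let ?T = "\<lambda>j. {z \<in> topspace pulled_back. fst z \<in> U j}"
  have fst: "continuous_map pulled_back B fst" and snd: "continuous_map pulled_back (EGF F I) snd"
    unfolding pullback_space_def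
    by (auto intro: continuous_map_from_subtopology continuous_map_fst continuous_map_snd)
  have h: "continuous_map E pulled_back ?h"
    using continuous_map_pairedI[OF continuous_proj continuous_map_bundle_map]
      bundle_map_in_pulled_back
    unfolding pullback_space_def[of B] topspace_pulled_back continuous_map_in_subtopology
    by auto
  have hs: "?s j z \<in> topspace E" "?h (?s j z) = z" "p (?s j z) = fst z"
    if "z \<in> topspace pulled_back" "j \<in> I" "fst z \<in> U j" for j z
    using that bundle_map_section[of "fst z" "snd z" j] by (cases z; simp)+
  have sh: "?s j (?h x) = x" if "j \<in> I" "x \<in> topspace E" "p x \<in> U j" for j x
    using bundle_map_retract[OF that] by simp
  have k: "continuous_map pulled_back E ?k"
  proof (rule pasting_lemma[where I = I and T = ?T and f = ?s])
    fix j assume j: "j \<in> I"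
    show "openin pulled_back (?T j)"
      using openin_continuous_map_preimage[OF fst open_U[OF j]] .
    let ?X = "subtopology pulled_back (?T j)"
    have "continuous_map ?X (subtopology (EGF F I) (coord_domain F I j)) snd"
      using continuous_map_from_subtopology[OF snd] pulled_back_normal_form(1)[OF _ j]
      by (auto simp: continuous_map_in_subtopology)
    from continuous_map_compose[OF this continuous_map_assoc_coord[OF F j]]
    have "continuous_map ?X F (\<lambda>z. assoc_coord j (snd z))" by (simp add: o_def)
    moreover have "continuous_map ?X (subtopology B (U j)) fst"
      using continuous_map_from_subtopology[OF fst] by (auto simp: continuous_map_in_subtopology)
    ultimately have "continuous_map ?X (prod_topology (subtopology B (U j)) F)
        (\<lambda>z. (fst z, assoc_coord j (snd z)))"
      by (intro continuous_map_pairedI)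
    moreover have "continuous_map (prod_topology (subtopology B (U j)) F) E (\<psi> j)"
      using charts[OF j] by (auto simp: homeomorphic_maps_def continuous_map_in_subtopology)
    ultimately show "continuous_map ?X E (?s j)"
      using continuous_map_compose by (fastforce simp: o_def case_prod_unfold)
  next
    fix i j z assume "i \<in> I" "j \<in> I" and z: "z \<in> topspace pulled_back \<inter> ?T i \<inter> ?T j"
    \<comment> \<open>Both sides have the image \<open>z\<close> under the bundle map, and \<open>?s j\<close> is a left inverse of it.\<close>
    then show "?s i z = ?s j z"
      using hs[of z i] sh[of j "?s i z"] by simp
  next
    fix z assume z: "z \<in> topspace pulled_back"
    then have "fst z \<in> topspace B" by (auto simp: topspace_pulled_back)
    from chart_at[OF this] z show "\<exists>j. j \<in> I \<and> z \<in> ?T j \<and> ?k z = ?s j z" by blast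
  qed
  have "?h (?k z) = z" if "z \<in> topspace pulled_back" for z
    using that hs(2)[OF that] chart_at[of "fst z"] by (auto simp: topspace_pulled_back)
  moreover have "?k (?h x) = x" if "x \<in> topspace E" for x
    using that sh chart_at[OF proj_in[OF that]] by simp
  ultimately have "homeomorphic_maps E pulled_back ?h ?k"
    using h k by (simp add: homeomorphic_maps_def)
  then have "homeomorphic_map E pulled_back ?h" by (auto simp: homeomorphic_map_maps)
  then show ?thesis
    unfolding isomorphic_over_def using continuous_proj fst by force
qed

end

text \<open>Reindexing along \<open>\<beta>\<close> turns the index set of the cover into the set \<open>I\<close> that indexes the
  coordinates of \<open>E\<^sup>\<kappa> G\<close>.\<close>

lemma trivializing_cover_imp_atlas:
  assumes p: "continuous_map E B p" and U: "trivializing_cover F E B p J U"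
    and \<beta>: "bij_betw \<beta> I J"
  obtains \<phi> \<psi> where "bundle_atlas F E B p I (U \<circ> \<beta>) \<phi> \<psi>"
proof -
  have \<beta>I: "\<beta> ` I = J" using \<beta> by (rule bij_betw_imp_surj_on)
  have "\<forall>i\<in>I. \<exists>\<phi>. local_trivialization F E B p ((U \<circ> \<beta>) i) \<phi>"
    using U \<beta>I by (auto simp: trivializing_cover_def)
  then obtain \<phi> where \<phi>: "\<And>i. i \<in> I \<Longrightarrow> local_trivialization F E B p ((U \<circ> \<beta>) i) (\<phi> i)"
    using bchoice[of I "\<lambda>i. local_trivialization F E B p ((U \<circ> \<beta>) i)"] by blast
  let ?maps = "\<lambda>i. homeomorphic_maps (subtopology E {x \<in> topspace E. p x \<in> (U \<circ> \<beta>) i})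
      (prod_topology (subtopology B ((U \<circ> \<beta>) i)) F) (\<phi> i)"
  have "\<forall>i\<in>I. \<exists>\<psi>. ?maps i \<psi>"
    using \<phi> unfolding local_trivialization_def homeomorphic_map_maps by blast
  then obtain \<psi> where "\<And>i. i \<in> I \<Longrightarrow> ?maps i (\<psi> i)"
    using bchoice[of I ?maps] by blast
  moreover have "\<And>i. i \<in> I \<Longrightarrow> openin B ((U \<circ> \<beta>) i)" "(\<Union>i\<in>I. (U \<circ> \<beta>) i) = topspace B"
    using U \<beta>I by (auto simp: trivializing_cover_def)
  ultimately have "bundle_atlas F E B p I (U \<circ> \<beta>) \<phi> \<psi>"
    using p \<phi> by unfold_locales (simp_all add: local_trivialization_def)
  then show thesis by (rule that)
qed

theorem corollary2p9:
  fixes F :: "'f topology" and E :: "'e topology" and B :: "'b topology"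
    and p :: "'e \<Rightarrow> 'b" and \<kappa> :: "'k rel"
    and I :: "'i set" and J :: "'j set" and U :: "'j \<Rightarrow> 'b set"
  assumes F: "(compact_space F \<and> Hausdorff_space F) \<or>
      (locally_connected_space F \<and> locally_compact_space F \<and> Hausdorff_space F)"
    and \<kappa>: "Card_order \<kappa>" "|I| =o \<kappa>" "|J| =o \<kappa>"
    and p: "fiber_bundle F E B p"
    and U: "trivializing_cover F E B p J U"
  shows "\<exists>f. continuous_map B (B_space (Homeo F) (Homeo_topology F) I) f \<and>
      isomorphic_over B E p
        (pullback_space B f
          (assoc_space (Homeo F) (Homeo_topology F) I F (\<lambda>g y. g y))
          (assoc_proj (Homeo F) (Homeo_topology F) I))
        fst"
proof -
  have "|I| =o |J|" using \<kappa>(2,3) ordIso_symmetric ordIso_transitive by blast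
  then obtain \<beta> where \<beta>: "bij_betw \<beta> I J" using card_of_ordIso by blast
  have "continuous_map E B p" using p by (simp add: fiber_bundle_def)
  then obtain \<phi> \<psi> where "bundle_atlas F E B p I (U \<circ> \<beta>) \<phi> \<psi>"
    using trivializing_cover_imp_atlas[OF _ U \<beta>] by metis
  then interpret bundle_atlas F E B p I "U \<circ> \<beta>" \<phi> \<psi> .
  have "locally_compact_space F" "Hausdorff_space F"
    using F compact_imp_locally_compact_space by auto
  then show ?thesis
    using continuous_map_classifying_map isomorphic_pullback_classifying_map by blast
qed

end
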